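(* Consider the following setting. Points in the plane are inserted and deleted; the $x$- and $y$-coordinates of inserted points are continuously drawn (i.e. always from the same, never changing distribution) from an unknown continuous $\mu$-random distribution, and deleted points are chosen uniformly at random among the stored points. Let $n$ be the number of stored points at the latest reconstruction, at which the range of $x$-coordinates is partitioned, according to $x$-coordinate, into $n/\log n$ buckets, each represented by the point of minimum $y$-coordinate among the points it contains. Call an updated point violating if its insertion into or deletion from its bucket changes the representative of that bucket. Then for a sequence (epoch) of $O(\log n)$ updates following the reconstruction, the expected number of violating elements is $O(1)$.
   Context: A distribution is $\mu$-random if elements are drawn randomly with respect to a density function $\mu$ (here unknown). During the epoch the number of stored points stays in $[n, rn]$ for a constant $r>1$. *)

theory Defs
  imports "HOL-Probability.Probability"
begin

text \<open>
  Only the kinds of the updates are prescribed (arbitrarily); which points are inserted and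
  deleted is random. A point is identified by its label: the k-th inserted point, counting from 0,
  has label k, and its coordinates are \<open>\<omega> k\<close>.
\<close>

datatype update = Insert | Delete

definition num_stored :: "update list \<Rightarrow> nat" where
  "num_stored us = count_list us Insert - count_list us Delete"

text \<open>No deletion from an empty collection (starting with no stored point).\<close>

definition feasible :: "update list \<Rightarrow> bool" where
  "feasible us \<longleftrightarrow>
     (\<forall>m\<le>length us. count_list (take m us) Delete \<le> count_list (take m us) Insert)"

text \<open>
  The random list of labels of the updated points. Here k is the number of points inserted so far
  and S is the set of labels of the currently stored points.
\<close>

fun updated_labels :: "update list \<Rightarrow> nat \<Rightarrow> nat set \<Rightarrow> nat list pmf" where
  "updated_labels [] k S = return_pmf []"
| "updated_labels (Insert # us) k S =
     map_pmf ((#) k) (updated_labels us (Suc k) (insert k S))"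
| "updated_labels (Delete # us) k S =
     bind_pmf (pmf_of_set S) (\<lambda>i. map_pmf ((#) i) (updated_labels us k (S - {i})))"

text \<open>
  The coordinates are independent with common density \<open>\<mu>\<close> on the plane, and the deleted points are
  chosen irrespective of the coordinates.
\<close>

definition update_space ::
  "(real \<times> real \<Rightarrow> ennreal) \<Rightarrow> update list \<Rightarrow> (nat list \<times> (nat \<Rightarrow> real \<times> real)) measure" where
  "update_space \<mu> us =
     measure_pmf (updated_labels us 0 {}) \<Otimes>\<^sub>M (\<Pi>\<^sub>M k\<in>UNIV. density lborel \<mu>)"

text \<open>
  Labels of the points stored after the updates us, where ls lists the labels of the updated
  points; ls may be longer than us, the surplus is ignored.
\<close>

definition stored :: "update list \<Rightarrow> nat list \<Rightarrow> nat set" where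
  "stored us ls =
     fold (\<lambda>(u, i) S. case u of Insert \<Rightarrow> insert i S | Delete \<Rightarrow> S - {i}) (zip us ls) {}"

definition num_buckets :: "nat \<Rightarrow> nat" where
  "num_buckets n = nat \<lceil>real n / log 2 (real n)\<rceil>"

text \<open>
  Let S0 be the set of the n points stored at the reconstruction and K the number of buckets.
  The points of S0 are sorted by x-coordinate and cut into K consecutive groups of almost equal
  size (the floor or the ceiling of n / K); the j-th separator is the x-coordinate of the first
  point of group j. The separators of the groups 1, ..., K - 1 split the x-axis into the
  ranges of the K buckets, numbered 0, ..., K - 1.
\<close>

definition separator :: "(nat \<Rightarrow> real \<times> real) \<Rightarrow> nat set \<Rightarrow> nat \<Rightarrow> real" where
  "separator \<omega> S0 j =
     sorted_list_of_multiset (image_mset (\<lambda>i. fst (\<omega> i)) (mset_set S0))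
       ! (j * card S0 div num_buckets (card S0))"

definition bucket_of :: "(nat \<Rightarrow> real \<times> real) \<Rightarrow> nat set \<Rightarrow> real \<Rightarrow> nat" where
  "bucket_of \<omega> S0 x = card {j \<in> {1..<num_buckets (card S0)}. separator \<omega> S0 j \<le> x}"

definition bucket :: "(nat \<Rightarrow> real \<times> real) \<Rightarrow> nat set \<Rightarrow> nat set \<Rightarrow> nat \<Rightarrow> nat set" where
  "bucket \<omega> S0 S b = {i \<in> S. bucket_of \<omega> S0 (fst (\<omega> i)) = b}"

text \<open>
  The set of the points of minimum y-coordinate in bucket b when S is stored: empty for an empty
  bucket, and otherwise almost surely a singleton.
\<close>

definition representative :: "(nat \<Rightarrow> real \<times> real) \<Rightarrow> nat set \<Rightarrow> nat set \<Rightarrow> nat \<Rightarrow> nat set" where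
  "representative \<omega> S0 S b = {i. is_arg_min (\<lambda>i. snd (\<omega> i)) (\<lambda>i. i \<in> bucket \<omega> S0 S b) i}"

text \<open>The update of point i takes the set of stored points from S to S'.\<close>

definition violating ::
  "(nat \<Rightarrow> real \<times> real) \<Rightarrow> nat set \<Rightarrow> nat set \<Rightarrow> nat set \<Rightarrow> nat \<Rightarrow> bool" where
  "violating \<omega> S0 S S' i \<longleftrightarrow>
     (let b = bucket_of \<omega> S0 (fst (\<omega> i))
      in representative \<omega> S0 S b \<noteq> representative \<omega> S0 S' b)"

text \<open>The reconstruction takes place after the updates hist; the updates ep form the epoch.\<close>

definition num_violating ::
  "update list \<Rightarrow> update list \<Rightarrow> nat list \<times> (nat \<Rightarrow> real \<times> real) \<Rightarrow> nat" where
  "num_violating hist ep = (\<lambda>(ls, \<omega>).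
     card {m. m < length ep \<and>
       violating \<omega> (stored hist ls)
         (stored (hist @ take m ep) ls) (stored (hist @ take (Suc m) ep) ls)
         (ls ! (length hist + m))})"

end

theory Submission
  imports Defs "HOL-Combinatorics.Transposition"
begin

text \<open>
  An update can only be violating if the updated point is a lowest point of its bucket within the
  larger of the two stored sets. Almost surely all \<open>y\<close>-coordinates differ, and then at most \<open>K\<close>
  stored points are lowest in their bucket, where \<open>K\<close> is the number of buckets; so the uniformly
  chosen deleted point is violating with probability at most \<open>K / n\<close>.

  For an insertion of \<open>k\<close>, the points \<open>A\<close> of the reconstruction that survive and \<open>k\<close> itself are
  exchangeable. If \<open>k\<close> trades places with each point of \<open>A \<union> {k}\<close> in turn, the separators move, but
  still at most \<open>K\<close> of these configurations are violating, so the probability is at most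
  \<open>K / (|A| + 1)\<close>. If \<open>c log n \<le> n / 2\<close>, this is at most \<open>2 K / n \<le> 4 / log n\<close>, and the \<open>c log n\<close>
  updates contribute at most \<open>4 c\<close>. Otherwise \<open>log n \<le> 4 \<surd>n\<close> bounds the number of updates by
  \<open>32 c\<^sup>2\<close>.
\<close>

subsection \<open>Buckets and their lowest points\<close>

text \<open>In a sorted list the entries at most \<open>x\<close> form a prefix, and index
  \<open>q\<close> lies in it exactly when the prefix is longer than \<open>q\<close>.\<close>

lemma nth_le_iff_length_filter:
  fixes x :: "'a :: linorder"
  assumes "sorted xs" "q < length xs"
  shows "xs ! q \<le> x \<longleftrightarrow> q < length (filter (\<lambda>y. y \<le> x) xs)"
  using assms
proof (induction xs arbitrary: q)
  case (Cons a xs)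
  show ?case
  proof (cases "a \<le> x")
    case True
    then show ?thesis using Cons by (cases q) auto
  next
    case False
    then have "\<forall>y\<in>set (a # xs). \<not> y \<le> x" using Cons.prems by auto
    then have "filter (\<lambda>y. y \<le> x) (a # xs) = []" by (simp add: filter_empty_conv)
    moreover have "\<not> (a # xs) ! q \<le> x"
      using \<open>\<forall>y\<in>set (a # xs). \<not> y \<le> x\<close> Cons.prems(2) nth_mem by blast
    ultimately show ?thesis by simp
  qed
qed simp

text \<open>Comparing an order statistic with \<open>x\<close> becomes counting, which removes the
  sorted list from all later arguments. Equal values of \<open>f\<close> do no harm, because
  multiplicities are counted.\<close>

lemma sorted_list_of_image_mset_nth_le_iff:
  fixes f :: "'b \<Rightarrow> 'a :: linorder"
  assumes "finite S" "q < card S"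
  shows "sorted_list_of_multiset (image_mset f (mset_set S)) ! q \<le> x
    \<longleftrightarrow> q < card {s \<in> S. f s \<le> x}"
proof -
  let ?xs = "sorted_list_of_multiset (image_mset f (mset_set S))"
  have mset: "mset ?xs = image_mset f (mset_set S)" by simp
  have len: "length ?xs = card S"
    using arg_cong[OF mset, of size] by (simp only: size_mset size_image_mset size_mset_set)
  have "length (filter (\<lambda>y. y \<le> x) ?xs) = size (filter_mset (\<lambda>y. y \<le> x) (image_mset f (mset_set S)))"
    by (metis mset mset_filter size_mset)
  also have "\<dots> = card {s \<in> S. f s \<le> x}"
    using assms(1) by (simp add: filter_mset_image_mset)
  finally show ?thesis
    using nth_le_iff_length_filter[of ?xs q x] assms(2) len by simp
qed

definition num_left :: "(nat \<Rightarrow> real \<times> real) \<Rightarrow> nat set \<Rightarrow> real \<Rightarrow> nat" where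
  "num_left \<omega> S x = card {s \<in> S. fst (\<omega> s) \<le> x}"

text \<open>The bucket index as a function of rank alone. Once it is separated from the coordinates,
  it stays the same when points trade places; only the ranks change.\<close>

definition bucket_of_rank :: "nat \<Rightarrow> nat \<Rightarrow> nat" where
  "bucket_of_rank n a = card {j \<in> {1..<num_buckets n}. j * n div num_buckets n < a}"

lemma bucket_of_rank_mono: "a \<le> b \<Longrightarrow> bucket_of_rank n a \<le> bucket_of_rank n b"
  unfolding bucket_of_rank_def by (rule card_mono) auto

lemma bucket_of_eq:
  assumes "finite S0"
  shows "bucket_of \<omega> S0 x = bucket_of_rank (card S0) (num_left \<omega> S0 x)"
proof -
  let ?n = "card S0"
  have "separator \<omega> S0 j \<le> x \<longleftrightarrow> j * ?n div num_buckets ?n < num_left \<omega> S0 x"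
    if "j \<in> {1..<num_buckets ?n}" for j
  proof -
    have "?n > 0" using that by (cases "?n = 0") (auto simp: num_buckets_def)
    \<comment> \<open>Since \<open>j\<close> is less than the number of buckets, the position looked
      up by \<open>separator\<close> is inside the list.\<close>
    then have "j * ?n div num_buckets ?n < ?n"
      using that by (intro less_mult_imp_div_less) (auto simp: mult.commute)
    then show ?thesis
      unfolding separator_def num_left_def
      by (rule sorted_list_of_image_mset_nth_le_iff[OF assms])
  qed
  then show ?thesis
    unfolding bucket_of_def bucket_of_rank_def
    by (intro arg_cong[where f = card] Collect_cong) auto
qed

lemma bucket_of_less:
  assumes "num_buckets (card S0) > 0"
  shows "bucket_of \<omega> S0 x < num_buckets (card S0)"
proof -
  have "bucket_of \<omega> S0 x \<le> card {1..<num_buckets (card S0)}"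
    unfolding bucket_of_def by (rule card_mono) auto
  then show ?thesis using assms by simp
qed

section \<open>Representatives and lowest points\<close>

lemma in_representative_iff:
  "i \<in> representative \<omega> S0 S b \<longleftrightarrow> i \<in> S \<and> bucket_of \<omega> S0 (fst (\<omega> i)) = b \<and>
     (\<forall>j\<in>S. bucket_of \<omega> S0 (fst (\<omega> j)) = b \<longrightarrow> snd (\<omega> i) \<le> snd (\<omega> j))"
  unfolding representative_def bucket_def is_arg_min_def by (auto simp: not_less)

definition lowest :: "(nat \<Rightarrow> real \<times> real) \<Rightarrow> nat set \<Rightarrow> nat set \<Rightarrow> nat \<Rightarrow> bool" where
  "lowest \<omega> S0 S i \<longleftrightarrow> i \<in> representative \<omega> S0 S (bucket_of \<omega> S0 (fst (\<omega> i)))"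

lemma lowest_iff:
  "lowest \<omega> S0 S i \<longleftrightarrow> i \<in> S \<and>
     (\<forall>j\<in>S. bucket_of \<omega> S0 (fst (\<omega> j)) = bucket_of \<omega> S0 (fst (\<omega> i)) \<longrightarrow> snd (\<omega> i) \<le> snd (\<omega> j))"
  unfolding lowest_def in_representative_iff by simp

lemma lowest_mono: "lowest \<omega> S0 S i \<Longrightarrow> T \<subseteq> S \<Longrightarrow> i \<in> T \<Longrightarrow> lowest \<omega> S0 T i"
  by (auto simp: lowest_iff)

text \<open>A point that is not lowest has a strictly lower point \<open>l\<close> in its bucket. As
  \<open>l\<close> remains after the removal, \<open>i\<close> is a minimum neither before nor
  after, and every minimum over the rest is strictly below \<open>i\<close>.\<close>

lemma representative_remove:
  assumes "\<not> lowest \<omega> S0 S i" "i \<in> S" "b = bucket_of \<omega> S0 (fst (\<omega> i))"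
  shows "representative \<omega> S0 (S - {i}) b = representative \<omega> S0 S b"
proof -
  obtain l where l: "l \<in> S" "bucket_of \<omega> S0 (fst (\<omega> l)) = b" "snd (\<omega> l) < snd (\<omega> i)"
    using assms by (auto simp: lowest_iff not_le)
  show ?thesis
  proof (rule set_eqI)
    fix j
    show "j \<in> representative \<omega> S0 (S - {i}) b \<longleftrightarrow> j \<in> representative \<omega> S0 S b"
    proof
      assume j: "j \<in> representative \<omega> S0 (S - {i}) b"
      have "l \<in> S - {i}" using l by auto
      with j l have "snd (\<omega> j) < snd (\<omega> i)" by (force simp: in_representative_iff)
      with j show "j \<in> representative \<omega> S0 S b"
        unfolding in_representative_iff using assms(2) by (metis Diff_iff insertE empty_iff less_imp_le)
    next
      assume j: "j \<in> representative \<omega> S0 S b"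
      then have "snd (\<omega> j) < snd (\<omega> i)" using l by (force simp: in_representative_iff)
      with j show "j \<in> representative \<omega> S0 (S - {i}) b" by (auto simp: in_representative_iff)
    qed
  qed
qed

text \<open>Insertion is removal read backwards, with \<open>insert i S\<close> as the larger
  set.\<close>

lemma violating_insert:
  assumes "violating \<omega> S0 S (insert i S) i" "i \<notin> S"
  shows "lowest \<omega> S0 (insert i S) i"
  using assms representative_remove[of \<omega> S0 "insert i S" i] by (auto simp: violating_def Let_def)

lemma violating_delete:
  assumes "violating \<omega> S0 S (S - {i}) i" "i \<in> S"
  shows "lowest \<omega> S0 S i"
  using assms representative_remove[of \<omega> S0 S i] by (auto simp: violating_def Let_def)

text \<open>Two lowest points of the same bucket have equal y-coordinates, so the map from lowest
  points to their buckets is injective.\<close>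

lemma card_lowest_le:
  assumes "inj_on (\<lambda>i. snd (\<omega> i)) S" "num_buckets (card S0) > 0"
  shows "card {i \<in> S. lowest \<omega> S0 S i} \<le> num_buckets (card S0)"
proof -
  let ?f = "\<lambda>i. bucket_of \<omega> S0 (fst (\<omega> i))"
  have "card {i \<in> S. lowest \<omega> S0 S i} \<le> card {..<num_buckets (card S0)}"
  proof (rule card_inj_on_le)
    show "inj_on ?f {i \<in> S. lowest \<omega> S0 S i}"
      by (rule inj_onI) (metis (mono_tags, lifting) assms(1) antisym inj_onD lowest_iff mem_Collect_eq)
  qed (use bucket_of_less[OF assms(2)] in auto)
  then show ?thesis by simp
qed

section \<open>Exchanging the inserted point with a stored one\<close>

text \<open>After the exchange the labels in \<open>S0\<close> occupy the old places of all points
  of \<open>insert k S0\<close> except \<open>i\<close>, which is where \<open>k\<close> now sits.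
  For \<open>i = k\<close> nothing moves.\<close>

lemma num_left_transpose:
  assumes "k \<notin> S0" "i \<in> insert k S0"
  shows "num_left (\<omega> \<circ> Transposition.transpose k i) S0 x = num_left \<omega> (insert k S0 - {i}) x"
proof -
  have "bij_betw (Transposition.transpose k i) {s \<in> S0. fst ((\<omega> \<circ> Transposition.transpose k i) s) \<le> x}
     {s \<in> insert k S0 - {i}. fst (\<omega> s) \<le> x}"
    by (rule bij_betwI[where g = "Transposition.transpose k i"])
       (use assms in \<open>auto simp: Transposition.transpose_def split: if_splits\<close>)
  then show ?thesis unfolding num_left_def by (rule bij_betw_same_card)
qed

lemma num_left_remove:
  assumes "finite P" "i \<in> P"
  shows "num_left \<omega> P x = num_left \<omega> (P - {i}) x + (if fst (\<omega> i) \<le> x then 1 else 0)"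
proof -
  have "{s \<in> P. fst (\<omega> s) \<le> x} = (if fst (\<omega> i) \<le> x then insert i {s \<in> P - {i}. fst (\<omega> s) \<le> x}
      else {s \<in> P - {i}. fst (\<omega> s) \<le> x})"
    using assms(2) by auto
  then show ?thesis using assms(1) by (simp add: num_left_def)
qed

text \<open>
  If \<open>k\<close> is placed at point \<open>i\<close>, the bucket of \<open>k\<close> depends monotonically on the rank of \<open>i\<close>; hence a
  point whose own placement leads to the same bucket lies in that bucket for either placement.
\<close>

lemma card_lowest_transpose_le:
  assumes fin: "finite S0" and k: "k \<notin> S0" and A: "A \<subseteq> S0"
    and inj: "inj_on (\<lambda>i. snd (\<omega> i)) (insert k A)" and K: "num_buckets (card S0) > 0"
  shows "card {i \<in> insert k A. lowest (\<omega> \<circ> Transposition.transpose k i) S0 (insert k A) k}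
    \<le> num_buckets (card S0)"
proof -
  define P where "P = insert k S0"
  \<comment> \<open>\<open>N i x\<close> is the rank of \<open>x\<close> for the separators that
    arise when \<open>k\<close> sits at point \<open>i\<close>, and \<open>f i\<close> is then the
    bucket of \<open>k\<close>.\<close>
  define N where "N i x = num_left \<omega> (P - {i}) x" for i x
  define g where "g = bucket_of_rank (card S0)"
  define f where "f i = g (N i (fst (\<omega> i)))" for i
  let ?V = "{i \<in> insert k A. lowest (\<omega> \<circ> Transposition.transpose k i) S0 (insert k A) k}"
  have finP: "finite P" using fin by (simp add: P_def)
  have bucket: "bucket_of (\<omega> \<circ> Transposition.transpose k i) S0 x = g (N i x)" if "i \<in> insert k A" for i x
    using that A k unfolding bucket_of_eq[OF fin] g_def N_def P_def
    by (subst num_left_transpose) auto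
  have low: "snd (\<omega> i) \<le> snd (\<omega> j)"
    if "i \<in> ?V" "j \<in> insert k A" "g (N i (fst (\<omega> j))) = f i" for i j
  proof (cases "i = j")
    case False
    \<comment> \<open>\<open>j'\<close> is the label found at the place of \<open>j\<close> after
      the exchange; it is still in \<open>insert k A\<close>, so \<open>k\<close> at
      \<open>i\<close> can be compared with it.\<close>
    define j' where "j' = Transposition.transpose k i j"
    have j': "j' \<in> insert k A" "Transposition.transpose k i j' = j"
      using that(1,2) by (auto simp: j'_def Transposition.transpose_def)
    have "i \<in> insert k A" using that(1) by auto
    have "\<forall>l\<in>insert k A. g (N i (fst ((\<omega> \<circ> Transposition.transpose k i) l))) = g (N i (fst (\<omega> i))) \<longrightarrow>
       snd (\<omega> i) \<le> snd ((\<omega> \<circ> Transposition.transpose k i) l)"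
      using that(1) unfolding lowest_iff mem_Collect_eq bucket[OF \<open>i \<in> insert k A\<close>] by simp
    then show ?thesis using j' that(3) by (auto simp: f_def)
  qed simp
  have aux: "g (N i' (fst (\<omega> i))) = f i'"
    if "i \<in> P" "i' \<in> P" "f i = f i'" for i i'
  proof (cases "fst (\<omega> i') \<le> fst (\<omega> i)")
    case True
    \<comment> \<open>Both \<open>i\<close> and \<open>i'\<close> are counted at the x-coordinate of
      \<open>i\<close>, so leaving out either one lowers the rank by one.\<close>
    then have "N i' (fst (\<omega> i)) = N i (fst (\<omega> i))"
      using num_left_remove[OF finP that(1), of \<omega> "fst (\<omega> i)"]
        num_left_remove[OF finP that(2), of \<omega> "fst (\<omega> i)"] by (simp add: N_def)
    then show ?thesis using that(3) by (simp add: f_def)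
  next
    case False
    \<comment> \<open>Here \<open>i'\<close> is strictly to the right of \<open>i\<close>. The rank
      in question is squeezed between two ranks that \<open>g\<close> sends to the common value
      \<open>f i = f i'\<close>, and \<open>g\<close> is monotone.\<close>
    have "N i (fst (\<omega> i)) \<le> N i' (fst (\<omega> i))"
      using False num_left_remove[OF finP that(1), of \<omega> "fst (\<omega> i)"]
        num_left_remove[OF finP that(2), of \<omega> "fst (\<omega> i)"] by (simp add: N_def)
    moreover have "N i' (fst (\<omega> i)) \<le> N i' (fst (\<omega> i'))"
      unfolding N_def num_left_def using False finP by (intro card_mono) auto
    ultimately show ?thesis
      using that(3) bucket_of_rank_mono[of _ _ "card S0"] unfolding f_def g_def
      by (metis order_antisym)
  qed
  have "card ?V \<le> card {..<num_buckets (card S0)}"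
  proof (rule card_inj_on_le)
    show "inj_on f ?V"
    proof (rule inj_onI)
      fix i i' assume *: "i \<in> ?V" "i' \<in> ?V" "f i = f i'"
      then have "i \<in> insert k A" "i' \<in> insert k A" "i \<in> P" "i' \<in> P" using A by (auto simp: P_def)
      \<comment> \<open>Each of the two points lies in the bucket of \<open>k\<close> when
        \<open>k\<close> is placed at the other, so neither can be strictly lower.\<close>
      then have "snd (\<omega> i) = snd (\<omega> i')"
        using low[OF *(1), of i'] low[OF *(2), of i] aux[of i i'] aux[of i' i] *(3) by force
      then show "i = i'" using inj_onD[OF inj] \<open>i \<in> insert k A\<close> \<open>i' \<in> insert k A\<close> by auto
    qed
    show "f ` ?V \<subseteq> {..<num_buckets (card S0)}"
    proof (rule image_subsetI)
      fix i assume "i \<in> ?V"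
      then have "f i = bucket_of (\<omega> \<circ> Transposition.transpose k i) S0 (fst (\<omega> i))"
        using bucket[of i] by (simp add: f_def)
      then show "f i \<in> {..<num_buckets (card S0)}" using bucket_of_less[OF K] by simp
    qed
  qed simp
  then show ?thesis by simp
qed

subsection \<open>The random labels\<close>

fun update_set :: "update \<Rightarrow> nat \<Rightarrow> nat set \<Rightarrow> nat set" where
  "update_set Insert i S = insert i S"
| "update_set Delete i S = S - {i}"

lemma zip_take_eq: "zip (take t us) ls = take t (zip us ls)"
proof (induction us arbitrary: t ls)
  case (Cons a us)
  then show ?case by (cases t; cases ls) auto
qed simp

lemma stored_take_Suc:
  assumes "t < length us" "t < length ls"
  shows "stored (take (Suc t) us) ls = update_set (us ! t) (ls ! t) (stored (take t us) ls)"
proof -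
  have "zip (take (Suc t) us) ls = zip (take t us) ls @ [(us ! t, ls ! t)]"
    using assms
    by (metis length_zip min_less_iff_conj nth_zip take_Suc_conv_app_nth take_zip zip_take_eq)
  then show ?thesis unfolding stored_def by (cases "us ! t") simp_all
qed

lemma stored_take: "stored us (take (length us) ls) = stored us ls"
proof -
  have "zip us (take (length us) ls) = zip us ls"
  proof (induction us arbitrary: ls)
    case (Cons a us)
    then show ?case by (cases ls) auto
  qed simp
  then show ?thesis by (simp add: stored_def)
qed

lemma stored_append: "length ls = length us \<Longrightarrow>
  stored (us @ [u]) (ls @ [i]) = update_set u i (stored us ls)"
  unfolding stored_def by (cases u) simp_all

text \<open>The recursion defining \<open>updated_labels\<close> peels off the first update, whereas
  the probability bounds condition on the past and look at the last one. The \<open>fold\<close> is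
  the stored set reached from \<open>S\<close>.\<close>

lemma updated_labels_append:
  "updated_labels (us @ [u]) k S = bind_pmf (updated_labels us k S) (\<lambda>ls. map_pmf (\<lambda>i. ls @ [i])
     (case u of Insert \<Rightarrow> return_pmf (k + count_list us Insert)
      | Delete \<Rightarrow> pmf_of_set (fold (\<lambda>(u, i) S. case u of Insert \<Rightarrow> insert i S | Delete \<Rightarrow> S - {i}) (zip us ls) S)))"
proof (induction us k S rule: updated_labels.induct)
  case (1 k S)
  then show ?case
    by (cases u) (simp_all add: bind_return_pmf map_pmf_def)
next
  case (2 us k S)
  then show ?case
    by (cases u) (simp_all add: map_bind_pmf bind_map_pmf pmf.map_comp o_def)
next
  case (3 us k S)
  have "updated_labels ((Delete # us) @ [u]) k S =
    bind_pmf (pmf_of_set S) (\<lambda>i. map_pmf ((#) i) (updated_labels (us @ [u]) k (S - {i})))"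
    by simp
  also have "\<dots> = bind_pmf (pmf_of_set S) (\<lambda>i. map_pmf ((#) i)
      (bind_pmf (updated_labels us k (S - {i})) (\<lambda>ls. map_pmf (\<lambda>i. ls @ [i])
     (case u of Insert \<Rightarrow> return_pmf (k + count_list us Insert)
      | Delete \<Rightarrow> pmf_of_set (fold (\<lambda>(u, i) S. case u of Insert \<Rightarrow> insert i S | Delete \<Rightarrow> S - {i}) (zip us ls) (S - {i}))))))"
    by (intro bind_pmf_cong refl arg_cong[where f = "map_pmf _"] 3)
  finally show ?case
    by (cases u) (simp_all add: map_bind_pmf bind_map_pmf pmf.map_comp o_def bind_assoc_pmf)
qed

lemma updated_labels_append_empty:
  "updated_labels (us @ [u]) 0 {} = bind_pmf (updated_labels us 0 {}) (\<lambda>ls. map_pmf (\<lambda>i. ls @ [i])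
     (case u of Insert \<Rightarrow> return_pmf (count_list us Insert) | Delete \<Rightarrow> pmf_of_set (stored us ls)))"
  unfolding stored_def using updated_labels_append[of us u 0 "{}"] by (simp only: add_0)

text \<open>Later updates have no influence on the law of earlier labels.\<close>

lemma map_take_updated_labels:
  "map_pmf (take t) (updated_labels us k S) = updated_labels (take t us) k S"
proof (induction us k S arbitrary: t rule: updated_labels.induct)
  case (2 us k S)
  show ?case by (cases t) (simp_all add: pmf.map_comp o_def 2[symmetric] map_pmf_const)
next
  case (3 us k S)
  show ?case
  proof (cases t)
    case (Suc t')
    have "map_pmf (take t) (updated_labels (Delete # us) k S) =
      bind_pmf (pmf_of_set S) (\<lambda>i. map_pmf ((#) i) (map_pmf (take t') (updated_labels us k (S - {i}))))"
      by (simp add: Suc map_bind_pmf pmf.map_comp o_def)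
    also have "\<dots> = bind_pmf (pmf_of_set S) (\<lambda>i. map_pmf ((#) i) (updated_labels (take t' us) k (S - {i})))"
      by (intro bind_pmf_cong refl arg_cong[where f = "map_pmf _"] 3)
    finally show ?thesis by (simp add: Suc)
  qed simp
qed simp

lemma updated_labels_Suc:
  assumes "t < length us"
  shows "map_pmf (take (Suc t)) (updated_labels us 0 {}) =
    bind_pmf (updated_labels (take t us) 0 {}) (\<lambda>ls. map_pmf (\<lambda>i. ls @ [i])
     (case us ! t of Insert \<Rightarrow> return_pmf (count_list (take t us) Insert)
      | Delete \<Rightarrow> pmf_of_set (stored (take t us) ls)))"
  using assms
  by (simp add: map_take_updated_labels take_Suc_conv_app_nth updated_labels_append_empty)

lemma feasible_take: "feasible us \<Longrightarrow> feasible (take t us)"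
  unfolding feasible_def by (auto simp: take_take min_def)

lemma feasible_appendD: "feasible (us @ vs) \<Longrightarrow> feasible us"
  using feasible_take[of "us @ vs" "length us"] by simp

lemma feasible_count: "feasible us \<Longrightarrow> count_list us Delete \<le> count_list us Insert"
  unfolding feasible_def by (metis order_refl take_all)

text \<open>Feasibility keeps the stored set nonempty before each deletion, so
  \<open>pmf_of_set\<close> is a genuine uniform choice there. The bound on the labels makes each
  inserted label new. The cardinality is stated additively to avoid truncated subtraction.\<close>

lemma updated_labels_support:
  assumes "ls \<in> set_pmf (updated_labels us 0 {})" "feasible us"
  shows "length ls = length us \<and> finite (stored us ls) \<and> stored us ls \<subseteq> {..<count_list us Insert} \<and>
    card (stored us ls) + count_list us Delete = count_list us Insert"
  using assms
proof (induction us arbitrary: ls rule: rev_induct)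
  case Nil
  then show ?case by (simp add: stored_def)
next
  case (snoc u us)
  obtain ls' i where ls: "ls = ls' @ [i]" and ls': "ls' \<in> set_pmf (updated_labels us 0 {})"
    and i: "i \<in> set_pmf (case u of Insert \<Rightarrow> return_pmf (count_list us Insert)
      | Delete \<Rightarrow> pmf_of_set (stored us ls'))"
    using snoc.prems(1) by (auto simp: updated_labels_append_empty)
  have f: "feasible us" using snoc.prems(2) by (rule feasible_appendD)
  note IH = snoc.IH[OF ls' f]
  have st: "stored (us @ [u]) ls = update_set u i (stored us ls')"
    using IH by (simp add: ls stored_append)
  show ?case
  proof (cases u)
    case Insert
    then have "i = count_list us Insert" using i by simp
    moreover from this have "i \<notin> stored us ls'" using IH by auto
    ultimately show ?thesis using IH Insert unfolding st by (auto simp: ls)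
  next
    case Delete
    have "count_list us Delete < count_list us Insert"
      using feasible_count[OF snoc.prems(2)] Delete by simp
    then have "stored us ls' \<noteq> {}" using IH by auto
    then have "i \<in> stored us ls'" using i IH Delete by simp
    moreover from this have "card (stored us ls') > 0" using IH by (auto simp: card_gt_0_iff)
    ultimately show ?thesis using IH Delete unfolding st by (auto simp: ls card_Diff_singleton)
  qed
qed

lemma updated_labels_support_take:
  assumes "ls \<in> set_pmf (updated_labels us 0 {})" "feasible us"
  shows "finite (stored (take t us) ls)"
    "stored (take t us) ls \<subseteq> {..<count_list (take t us) Insert}"
    "card (stored (take t us) ls) = num_stored (take t us)"
proof -
  have "take t ls \<in> set_pmf (updated_labels (take t us) 0 {})"
    using assms(1) unfolding map_take_updated_labels[symmetric] by auto
  from updated_labels_support[OF this feasible_take[OF assms(2)]]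
  have *: "length (take t ls) = length (take t us)" "finite (stored (take t us) (take t ls))"
    "stored (take t us) (take t ls) \<subseteq> {..<count_list (take t us) Insert}"
    "card (stored (take t us) (take t ls)) + count_list (take t us) Delete = count_list (take t us) Insert"
    by auto
  have "stored (take t us) (take t ls) = stored (take t us) ls"
  proof -
    have "take (length (take t us)) (take t ls) = take (length (take t us)) ls"
      by (simp add: take_take min_def)
    then show ?thesis by (metis stored_take)
  qed
  with * show "finite (stored (take t us) ls)"
    "stored (take t us) ls \<subseteq> {..<count_list (take t us) Insert}"
    "card (stored (take t us) ls) = num_stored (take t us)"
    by (auto simp: num_stored_def)
qed

lemma updated_label_support:
  assumes "ls \<in> set_pmf (updated_labels us 0 {})" "feasible us" "t < length us"
  shows "us ! t = Insert \<Longrightarrow> ls ! t = count_list (take t us) Insert"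
    "us ! t = Delete \<Longrightarrow> ls ! t \<in> stored (take t us) ls"
proof -
  have "take (Suc t) ls \<in> set_pmf (map_pmf (take (Suc t)) (updated_labels us 0 {}))"
    using assms(1) by simp
  then obtain ls' i where ls': "ls' \<in> set_pmf (updated_labels (take t us) 0 {})"
    and i: "i \<in> set_pmf (case us ! t of Insert \<Rightarrow> return_pmf (count_list (take t us) Insert)
      | Delete \<Rightarrow> pmf_of_set (stored (take t us) ls'))"
    and eq: "take (Suc t) ls = ls' @ [i]"
    unfolding updated_labels_Suc[OF assms(3)] by auto
  have sup: "length ls' = t" "finite (stored (take t us) ls')"
    using updated_labels_support[OF ls' feasible_take[OF assms(2)]] assms(3) by auto
  have "take t (take (Suc t) ls) = ls'" unfolding eq using sup by simp
  then have ls'_eq: "ls' = take t ls" by (simp add: min_def)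
  have "ls ! t = take (Suc t) ls ! t" by simp
  then have ls_t: "ls ! t = i" unfolding eq using sup by (simp add: nth_append)
  show "ls ! t = count_list (take t us) Insert" if "us ! t = Insert"
    using i that by (simp add: ls_t)
  show "ls ! t \<in> stored (take t us) ls" if del: "us ! t = Delete"
  proof -
    have "take (Suc t) us = take t us @ [Delete]"
      using assms(3) del by (simp add: take_Suc_conv_app_nth)
    then have "count_list (take t us) Delete < count_list (take t us) Insert"
      using feasible_count[OF feasible_take[OF assms(2), of "Suc t"]] by simp
    then have "stored (take t us) ls' \<noteq> {}"
      using updated_labels_support[OF ls' feasible_take[OF assms(2)]] by auto
    then have "i \<in> stored (take t us) ls'" using i sup del by simp
    then show ?thesis
      using stored_take[of "take t us" ls] assms(3) by (simp add: ls_t ls'_eq min_def)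
  qed
qed

text \<open>Each update removes at most one label, so few points of the reconstruction are lost in a
  short epoch.\<close>

lemma card_stored_diff_le:
  assumes "length ls = length us" "h + m \<le> length us" "finite (stored (take h us) ls)"
  shows "card (stored (take h us) ls - stored (take (h + m) us) ls) \<le> m"
  using assms(2)
proof (induction m)
  case (Suc m)
  let ?D = "stored (take h us) ls - stored (take (h + m) us) ls"
  have "stored (take (Suc (h + m)) us) ls = update_set (us ! (h + m)) (ls ! (h + m)) (stored (take (h + m) us) ls)"
    using Suc.prems assms(1) by (intro stored_take_Suc) auto
  then have "stored (take h us) ls - stored (take (h + Suc m) us) ls \<subseteq> insert (ls ! (h + m)) ?D"
    by (cases "us ! (h + m)") auto
  then have "card (stored (take h us) ls - stored (take (h + Suc m) us) ls) \<le> card (insert (ls ! (h + m)) ?D)"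
    using assms(3) by (intro card_mono) auto
  also have "\<dots> \<le> Suc (card ?D)" by (simp add: card_insert_le_m1 card_insert_if assms(3))
  finally show ?case using Suc by simp
qed simp

lemma stored_cong:
  "take (length us) ls = take (length us) ls' \<Longrightarrow> stored us ls = stored us ls'"
  using stored_take[of us ls] stored_take[of us ls'] by simp

text \<open>Covers label lists outside the support as well, as measurability statements range over
  all lists.\<close>

lemma finite_stored: "finite (stored us ls)"
proof -
  have "finite (fold (\<lambda>(u, i) S. case u of Insert \<Rightarrow> insert i S | Delete \<Rightarrow> S - {i}) xs S)"
    if "finite S" for xs S using that
  proof (induction xs arbitrary: S)
    case (Cons x xs)
    then show ?case by (cases x) (auto split: update.split)
  qed simp
  then show ?thesis unfolding stored_def by blast
qed

subsection \<open>Independent coordinates\<close>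

text \<open>By Fubini: with all coordinates but the \<open>i\<close>-th fixed,
  \<open>f (\<omega> j)\<close> is a constant, which \<open>f\<close> of the \<open>i\<close>-th
  coordinate avoids almost surely. There are only countably many pairs \<open>i\<close>,
  \<open>j\<close>.\<close>

lemma AE_PiM_inj:
  fixes f :: "'a \<Rightarrow> real"
  assumes M: "prob_space M" and f [measurable]: "f \<in> borel_measurable M"
    and null: "\<And>c. AE x in M. f x \<noteq> c"
  shows "AE \<omega> in Pi\<^sub>M (UNIV :: nat set) (\<lambda>_. M). inj (\<lambda>i. f (\<omega> i))"
proof -
  have "AE \<omega> in Pi\<^sub>M UNIV (\<lambda>_. M). f (\<omega> i) \<noteq> f (\<omega> j)" if "i \<noteq> j" for i j :: nat
  proof -
    let ?P = "Pi\<^sub>M (UNIV - {i}) (\<lambda>_. M)" and ?T = "\<lambda>(x, X). X(i := x)"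
    have ins: "insert i (UNIV - {i}) = UNIV" by auto
    have meas [measurable]: "?T \<in> measurable (M \<Otimes>\<^sub>M ?P) (Pi\<^sub>M UNIV (\<lambda>_. M))"
      unfolding case_prod_beta by (rule measurable_fun_upd[where J = "UNIV - {i}"]) auto
    have comp [measurable]: "(\<lambda>\<omega>. f (\<omega> l)) \<in> borel_measurable (Pi\<^sub>M (UNIV :: nat set) (\<lambda>_. M))" for l
      by (rule measurable_compose[OF measurable_component_singleton[of l UNIV "\<lambda>_. M"] f]) simp
    have distr: "distr (M \<Otimes>\<^sub>M ?P) (Pi\<^sub>M UNIV (\<lambda>_. M)) ?T = Pi\<^sub>M UNIV (\<lambda>_. M)"
      using distr_pair_PiM_eq_PiM[of "UNIV - {i}" "\<lambda>_. M" i] M unfolding ins by simp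
    interpret M: prob_space M by fact
    interpret P: prob_space ?P by (intro prob_space_PiM M)
    interpret pair_sigma_finite ?P M ..
    interpret swap: pair_sigma_finite M ?P ..
    have j [measurable]: "j \<in> UNIV - {i}" using that by auto
    have "AE X in ?P. AE x in M. f x \<noteq> f (X j)" using null by simp
    \<comment> \<open>The hypothesis applies with \<open>X\<close> fixed outside, while the product
      \<open>M \<Otimes>\<^sub>M ?P\<close> needs the other order of quantifiers.\<close>
    then have "AE x in M. AE X in ?P. f x \<noteq> f (X j)"
      by (subst swap.AE_commute) measurable
    then have "AE z in M \<Otimes>\<^sub>M ?P. f (fst z) \<noteq> f (snd z j)"
      by (intro swap.AE_pair_measure) auto
    then have neq: "AE z in M \<Otimes>\<^sub>M ?P. f (?T z i) \<noteq> f (?T z j)"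
      using that by (simp add: case_prod_beta)
    have "{\<omega> \<in> space (Pi\<^sub>M UNIV (\<lambda>_. M)). f (\<omega> i) \<noteq> f (\<omega> j)} \<in> sets (Pi\<^sub>M UNIV (\<lambda>_. M))"
      by (intro borel_measurable_neq comp)
    with neq have "AE \<omega> in distr (M \<Otimes>\<^sub>M ?P) (Pi\<^sub>M UNIV (\<lambda>_. M)) ?T. f (\<omega> i) \<noteq> f (\<omega> j)"
      by (subst AE_distr_iff[OF meas])
    then show ?thesis unfolding distr .
  qed
  then have "AE \<omega> in Pi\<^sub>M UNIV (\<lambda>_. M). \<forall>i j :: nat. i \<noteq> j \<longrightarrow> f (\<omega> i) \<noteq> f (\<omega> j)"
    by (simp add: AE_all_countable)
  then show ?thesis by eventually_elim (auto simp: inj_def)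
qed

text \<open>Horizontal lines are Lebesgue null sets, and a measure with a density ignores null
  sets.\<close>

lemma AE_density_snd_neq:
  fixes \<mu> :: "real \<times> real \<Rightarrow> ennreal"
  assumes [measurable]: "\<mu> \<in> borel_measurable lborel"
  shows "AE p in density lborel \<mu>. snd p \<noteq> c"
proof -
  have "AE p in lborel \<Otimes>\<^sub>M lborel. snd (p :: real \<times> real) \<noteq> c"
  proof (rule lborel_pair.AE_pair_measure)
    show "{p \<in> space (lborel \<Otimes>\<^sub>M lborel). snd p \<noteq> c} \<in> sets ((lborel :: real measure) \<Otimes>\<^sub>M (lborel :: real measure))"
      by measurable
  qed (auto simp: AE_lborel_singleton)
  then have "AE p in lborel. snd (p :: real \<times> real) \<noteq> c"
    by (subst lborel_prod[symmetric])
  then show ?thesis by (auto simp: AE_density elim: eventually_mono)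
qed

text \<open>This is exchangeability of independent, identically distributed coordinates; it is
  applied to transpositions of labels.\<close>

lemma nn_integral_PiM_reindex:
  assumes M: "prob_space M" and f: "inj f" and g: "g \<in> borel_measurable (Pi\<^sub>M UNIV (\<lambda>_. M))"
  shows "(\<integral>\<^sup>+\<omega>. g (\<omega> \<circ> f) \<partial>Pi\<^sub>M UNIV (\<lambda>_. M)) = (\<integral>\<^sup>+\<omega>. g \<omega> \<partial>Pi\<^sub>M UNIV (\<lambda>_. M))"
proof -
  have distr: "distr (Pi\<^sub>M UNIV (\<lambda>_. M)) (Pi\<^sub>M UNIV (\<lambda>_. M)) (\<lambda>\<omega>. \<omega> \<circ> f) = Pi\<^sub>M UNIV (\<lambda>_. M)"
    using distr_PiM_reindex[of UNIV "\<lambda>_. M" f UNIV] M f by (simp add: comp_def restrict_def)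
  have "(\<lambda>\<omega>. \<omega> \<circ> f) \<in> measurable (Pi\<^sub>M UNIV (\<lambda>_. M)) (Pi\<^sub>M UNIV (\<lambda>_. M))"
    unfolding comp_def by (rule measurable_PiM_single') (auto simp: space_PiM PiE_iff)
  then show ?thesis
    using nn_integral_distr[of "\<lambda>\<omega>. \<omega> \<circ> f" "Pi\<^sub>M UNIV (\<lambda>_. M)" "Pi\<^sub>M UNIV (\<lambda>_. M)" g] g
    unfolding distr by simp
qed

section \<open>Measurability of buckets and exchangeability bound\<close>

context
  fixes M :: "(real \<times> real) measure"
  assumes sets_M: "sets M = sets borel"
begin

lemma measurable_fst_snd_component [measurable]:
  "(\<lambda>\<omega>. fst (\<omega> i)) \<in> borel_measurable (Pi\<^sub>M (UNIV :: nat set) (\<lambda>_. M))"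
  "(\<lambda>\<omega>. snd (\<omega> i)) \<in> borel_measurable (Pi\<^sub>M (UNIV :: nat set) (\<lambda>_. M))"
proof -
  have comp: "(\<lambda>\<omega>. \<omega> i) \<in> measurable (Pi\<^sub>M (UNIV :: nat set) (\<lambda>_. M)) borel"
    using measurable_component_singleton[of i UNIV "\<lambda>_. M"]
      measurable_cong_sets[OF refl sets_M, of "Pi\<^sub>M (UNIV :: nat set) (\<lambda>_. M)"] by simp
  have "fst \<in> borel_measurable (borel :: (real \<times> real) measure)"
    "snd \<in> borel_measurable (borel :: (real \<times> real) measure)"
    by (intro borel_measurable_continuous_onI continuous_intros)+
  then show "(\<lambda>\<omega>. fst (\<omega> i)) \<in> borel_measurable (Pi\<^sub>M (UNIV :: nat set) (\<lambda>_. M))"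
   "(\<lambda>\<omega>. snd (\<omega> i)) \<in> borel_measurable (Pi\<^sub>M (UNIV :: nat set) (\<lambda>_. M))"
    by (auto intro: measurable_compose[OF comp])
qed

lemma measurable_bucket_of:
  assumes "finite S0"
  shows "(\<lambda>\<omega>. bucket_of \<omega> S0 (fst (\<omega> i))) \<in> measurable (Pi\<^sub>M UNIV (\<lambda>_. M)) (count_space UNIV)"
proof -
  \<comment> \<open>Written as finite sums of indicators, the nested cardinalities are measurable by
    the standard rules.\<close>
  have card_eq: "card {j \<in> A. Q j} = (\<Sum>j\<in>A. if Q j then 1 else 0)" if "finite A" for A :: "nat set" and Q
    using that by (simp add: sum.If_cases Int_def conj_commute)
  show ?thesis
    unfolding bucket_of_eq[OF assms] bucket_of_rank_def num_left_def
      card_eq[OF assms] card_eq[OF finite_atLeastLessThan]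
    by measurable
qed

lemma pred_in_representative:
  assumes "finite S0"
  shows "Measurable.pred (Pi\<^sub>M UNIV (\<lambda>_. M))
    (\<lambda>\<omega>. j \<in> representative \<omega> S0 S (bucket_of \<omega> S0 (fst (\<omega> i))))"
proof -
  note measurable_bucket_of[OF assms, measurable]
  have [measurable]: "Measurable.pred (Pi\<^sub>M UNIV (\<lambda>_. M))
    (\<lambda>\<omega>. bucket_of \<omega> S0 (fst (\<omega> l)) = bucket_of \<omega> S0 (fst (\<omega> i)))" for l i
    by measurable
  have [measurable]: "Measurable.pred (Pi\<^sub>M UNIV (\<lambda>_. M)) (\<lambda>\<omega>. snd (\<omega> j) \<le> snd (\<omega> l))" for j l :: nat
    unfolding pred_def by (intro borel_measurable_le measurable_fst_snd_component)
  show ?thesis unfolding in_representative_iff by measurable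
qed

lemma pred_lowest:
  assumes "finite S0"
  shows "Measurable.pred (Pi\<^sub>M UNIV (\<lambda>_. M)) (\<lambda>\<omega>. lowest \<omega> S0 S i)"
  unfolding lowest_def by (rule pred_in_representative[OF assms])

lemma pred_violating:
  assumes "finite S0"
  shows "Measurable.pred (Pi\<^sub>M UNIV (\<lambda>_. M)) (\<lambda>\<omega>. violating \<omega> S0 S S' i)"
proof -
  note pred_in_representative[OF assms, measurable]
  show ?thesis unfolding violating_def Let_def set_eq_iff not_all by measurable
qed

text \<open>Double counting: the event has the same probability for each of the
  \<open>Suc (card A)\<close> places that \<open>k\<close> can take, while almost surely at most
  \<open>num_buckets (card S0)\<close> places make \<open>k\<close> lowest.\<close>

lemma emeasure_lowest_insert_le:
  assumes M: "prob_space M" and fin: "finite S0" and k: "k \<notin> S0" and A: "A \<subseteq> S0"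
    and K: "num_buckets (card S0) > 0"
    and inj: "AE \<omega> in Pi\<^sub>M (UNIV :: nat set) (\<lambda>_. M). inj (\<lambda>i. snd (\<omega> i))"
  shows "of_nat (Suc (card A)) * emeasure (Pi\<^sub>M UNIV (\<lambda>_. M))
      {\<omega> \<in> space (Pi\<^sub>M UNIV (\<lambda>_. M)). lowest \<omega> S0 (insert k A) k} \<le> of_nat (num_buckets (card S0))"
proof -
  let ?P = "Pi\<^sub>M (UNIV :: nat set) (\<lambda>_. M)" and ?t = "Transposition.transpose k"
  define g :: "(nat \<Rightarrow> real \<times> real) \<Rightarrow> ennreal"
    where "g \<omega> = (if lowest \<omega> S0 (insert k A) k then 1 else 0)" for \<omega>
  interpret P: prob_space ?P by (intro prob_space_PiM M)
  note pred_lowest[OF fin, measurable]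
  have g [measurable]: "g \<in> borel_measurable ?P"
    unfolding g_def by measurable
  have gt: "(\<lambda>\<omega>. g (\<omega> \<circ> ?t i)) \<in> borel_measurable ?P" for i
  proof -
    have "(\<lambda>\<omega>. \<omega> \<circ> ?t i) \<in> measurable ?P ?P"
      unfolding comp_def by (rule measurable_PiM_single') (auto simp: space_PiM PiE_iff)
    from measurable_compose[OF this g] show ?thesis .
  qed
  have finA: "finite A" "k \<notin> A" using A fin k by (auto intro: finite_subset)
  have "(\<integral>\<^sup>+\<omega>. g \<omega> \<partial>?P) = (\<integral>\<^sup>+\<omega>. indicator {\<omega> \<in> space ?P. lowest \<omega> S0 (insert k A) k} \<omega> \<partial>?P)"
    by (intro nn_integral_cong) (auto simp: g_def indicator_def)
  also have "\<dots> = emeasure ?P {\<omega> \<in> space ?P. lowest \<omega> S0 (insert k A) k}"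
    by (rule nn_integral_indicator) measurable
  finally have "of_nat (Suc (card A)) * emeasure ?P {\<omega> \<in> space ?P. lowest \<omega> S0 (insert k A) k}
      = (\<Sum>i\<in>insert k A. \<integral>\<^sup>+\<omega>. g \<omega> \<partial>?P)"
    using finA by simp
  also have "\<dots> = (\<Sum>i\<in>insert k A. \<integral>\<^sup>+\<omega>. g (\<omega> \<circ> ?t i) \<partial>?P)"
    using M by (intro sum.cong refl nn_integral_PiM_reindex[symmetric] g) auto
  also have "\<dots> = (\<integral>\<^sup>+\<omega>. (\<Sum>i\<in>insert k A. g (\<omega> \<circ> ?t i)) \<partial>?P)"
    by (intro nn_integral_sum[symmetric] gt)
  also have "\<dots> \<le> (\<integral>\<^sup>+\<omega>. of_nat (num_buckets (card S0)) \<partial>?P)"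
  proof (rule nn_integral_mono_AE)
    show "AE \<omega> in ?P. (\<Sum>i\<in>insert k A. g (\<omega> \<circ> ?t i)) \<le> of_nat (num_buckets (card S0))"
      using inj
    proof eventually_elim
      case (elim \<omega>)
      have "(\<Sum>i\<in>insert k A. g (\<omega> \<circ> ?t i)) =
        of_nat (card {i \<in> insert k A. lowest (\<omega> \<circ> ?t i) S0 (insert k A) k})"
        unfolding g_def using finA(1) by (subst sum.If_cases) (simp_all add: Int_def)
      also have "\<dots> \<le> of_nat (num_buckets (card S0))"
        using card_lowest_transpose_le[OF fin k A inj_on_subset[OF elim subset_UNIV] K]
        by (simp only: of_nat_le_iff)
      finally show ?case .
    qed
  qed
  also have "\<dots> = of_nat (num_buckets (card S0))" by (simp add: P.emeasure_space_1)
  finally show ?thesis .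
qed

end

subsection \<open>Probability of a violation\<close>

text \<open>The coordinates are fixed and only the labels are random. Given the first
  \<open>t\<close> labels, the deleted one is uniform on a stored set of at least \<open>n\<close>
  points, of which at most \<open>num_buckets n\<close> are lowest.\<close>

lemma emeasure_lowest_delete_le:
  assumes us: "feasible us" "h \<le> t" "t < length us" "us ! t = Delete"
    and n: "num_stored (take h us) = n" "n \<le> num_stored (take t us)" "n > 0" "num_buckets n > 0"
    and inj: "inj (\<lambda>i. snd (\<omega> i))"
  shows "emeasure (measure_pmf (updated_labels us 0 {}))
    {ls. lowest \<omega> (stored (take h us) ls) (stored (take t us) ls) (ls ! t)}
    \<le> ennreal (real (num_buckets n) / real n)"
proof -
  let ?V = "{ls. lowest \<omega> (stored (take h us) ls) (stored (take t us) ls) (ls ! t)}"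
  let ?p = "updated_labels us 0 {}" and ?q = "updated_labels (take t us) 0 {}"
  \<comment> \<open>The event is decided by the first \<open>Suc t\<close> labels, so the law of the
    truncated list suffices.\<close>
  have pre: "take (Suc t) ls \<in> ?V \<longleftrightarrow> ls \<in> ?V" for ls
  proof -
    have "stored (take h us) (take (Suc t) ls) = stored (take h us) ls"
      "stored (take t us) (take (Suc t) ls) = stored (take t us) ls"
      using us(2) by (auto intro!: stored_cong simp: min_def)
    then show ?thesis by simp
  qed
  have "emeasure (measure_pmf ?p) ?V = (\<integral>\<^sup>+ls. indicator ?V ls \<partial>map_pmf (take (Suc t)) ?p)"
  proof -
    have "(indicator ?V (take (Suc t) ls) :: ennreal) = indicator ?V ls" for ls
      using pre[of ls] unfolding indicator_def by (rule arg_cong)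
    then show ?thesis by (simp only: nn_integral_map_pmf) (simp only: nn_integral_indicator sets_measure_pmf UNIV_I)
  qed
  also have "\<dots> = (\<integral>\<^sup>+ls. (\<integral>\<^sup>+i. indicator ?V (ls @ [i]) \<partial>pmf_of_set (stored (take t us) ls)) \<partial>?q)"
    unfolding updated_labels_Suc[OF us(3)] by (simp add: us(4))
  also have "\<dots> \<le> (\<integral>\<^sup>+ls. ennreal (real (num_buckets n) / real n) \<partial>?q)"
  proof (rule nn_integral_mono_AE, unfold AE_measure_pmf_iff, rule ballI)
    fix ls assume ls: "ls \<in> set_pmf ?q"
    note feas = feasible_take[OF us(1), of t]
    let ?R = "stored (take h us) ls" and ?S = "stored (take t us) ls"
    have len: "length ls = t" using updated_labels_support[OF ls feas] us(3) by simp
    have "card ?S = num_stored (take t us)"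
      using updated_labels_support[OF ls feas] unfolding num_stored_def by linarith
    with n have S: "finite ?S" "n \<le> card ?S" "?S \<noteq> {}"
      using updated_labels_support[OF ls feas] by auto
    have S0: "card ?R = n"
      using updated_labels_support_take(3)[OF ls feas, of h] us(2) n(1) by (simp add: min_def)
    have st: "stored (take h us) (ls @ [i]) = ?R" "stored (take t us) (ls @ [i]) = ?S" for i
      using us(2) len by (auto intro!: stored_cong simp: min_def)
    have ind: "indicator ?V (ls @ [i]) = (indicator {i. lowest \<omega> ?R ?S i} i :: ennreal)" for i
      using len by (simp add: indicator_def st nth_append)
    have "(\<integral>\<^sup>+i. indicator ?V (ls @ [i]) \<partial>pmf_of_set ?S) =
      emeasure (measure_pmf (pmf_of_set ?S)) {i. lowest \<omega> ?R ?S i}"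
      unfolding ind by simp
    also have "\<dots> = ennreal (real (card (?S \<inter> {i. lowest \<omega> ?R ?S i})) / real (card ?S))"
      using S by (simp add: emeasure_pmf_of_set)
    also have "\<dots> \<le> ennreal (real (num_buckets n) / real n)"
    proof (intro ennreal_leI frac_le)
      have "card {i \<in> ?S. lowest \<omega> ?R ?S i} \<le> num_buckets n"
        using card_lowest_le[of \<omega> ?S ?R, OF inj_on_subset[OF inj subset_UNIV]] n(4)
        unfolding S0 by simp
      then show "real (card (?S \<inter> {i. lowest \<omega> ?R ?S i})) \<le> real (num_buckets n)"
        by (simp add: Int_def)
    qed (use n S in auto)
    finally show "(\<integral>\<^sup>+i. indicator ?V (ls @ [i]) \<partial>pmf_of_set ?S) \<le> ennreal (real (num_buckets n) / real n)" .
  qed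
  also have "\<dots> = ennreal (real (num_buckets n) / real n)" by simp
  finally show ?thesis .
qed

text \<open>For \<open>n \<ge> 2\<close> the logarithm is at most \<open>n\<close>, so the quotient
  is at least 1 and rounding it up at most doubles it.\<close>

lemma num_buckets_bounds:
  assumes "n \<ge> 2"
  shows "num_buckets n > 0" "real (num_buckets n) \<le> 2 * real n / log 2 (real n)"
proof -
  have l: "log 2 (real n) \<ge> 1" using assms by (subst le_log_iff) auto
  have "log 2 (real n) \<le> real n"
    using assms by (subst log_le_iff) (auto simp: powr_realpow of_nat_less_two_power less_imp_le)
  then have ge: "real n / log 2 (real n) \<ge> 1" using l assms by (simp add: le_divide_eq)
  show "num_buckets n > 0" unfolding num_buckets_def using ge by (simp add: less_ceiling_iff)
  have "real (num_buckets n) = of_int \<lceil>real n / log 2 (real n)\<rceil>"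
    unfolding num_buckets_def using ge by (intro of_nat_nat) (simp add: le_ceiling_iff)
  also have "\<dots> \<le> real n / log 2 (real n) + 1" by (rule of_int_ceiling_le_add_one)
  finally show "real (num_buckets n) \<le> 2 * real n / log 2 (real n)" using ge by simp
qed

text \<open>A crude bound from \<open>ln s \<le> s\<close> at \<open>s = sqrt n\<close> and
  \<open>ln 2 \<ge> 1/2\<close>.\<close>

lemma log2_le_sqrt: "n > 0 \<Longrightarrow> log 2 n \<le> 4 * sqrt n" for n :: real
proof -
  assume n: "n > 0"
  have "ln n = 2 * ln (sqrt n)" using n by (simp add: ln_sqrt)
  also have "\<dots> \<le> 2 * sqrt n" using n ln_bound[of "sqrt n"] by simp
  finally have "ln n \<le> 2 * sqrt n" .
  moreover have "ln 2 \<ge> (1/2 :: real)" by (subst ln_ge_iff) (auto simp: exp_half_le2)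
  moreover have "2 * sqrt n \<le> 4 * sqrt n * ln 2" using \<open>ln 2 \<ge> 1/2\<close> n by (simp add: field_simps)
  ultimately show ?thesis unfolding log_def by (simp add: divide_le_eq)
qed


text \<open>Label lists form a countable discrete space, so joint measurability reduces to that for
  each fixed list.\<close>

lemma pred_violating_pair:
  assumes M: "sets M = sets borel" and fin: "\<And>ls. finite (S0 ls)"
  shows "Measurable.pred (measure_pmf (p :: nat list pmf) \<Otimes>\<^sub>M Pi\<^sub>M UNIV (\<lambda>_. M))
    (\<lambda>w. violating (snd w) (S0 (fst w)) (S (fst w)) (S' (fst w)) (i (fst w)))"
proof -
  have "(\<lambda>w. violating (snd w) (S0 (fst w)) (S (fst w)) (S' (fst w)) (i (fst w)))
    \<in> measurable (count_space UNIV \<Otimes>\<^sub>M Pi\<^sub>M UNIV (\<lambda>_. M)) (count_space UNIV)"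
    by (rule measurable_pair_measure_countable1) (auto intro!: pred_violating[OF M fin])
  moreover have "sets (measure_pmf p \<Otimes>\<^sub>M Pi\<^sub>M UNIV (\<lambda>_. M)) =
      sets (count_space UNIV \<Otimes>\<^sub>M Pi\<^sub>M (UNIV :: nat set) (\<lambda>_. M))"
    by (intro sets_pair_measure_cong) auto
  ultimately show ?thesis by (subst measurable_cong_sets[OF _ refl])
qed

text \<open>A violating \<open>k\<close> is lowest in \<open>insert k S\<close>, hence also after
  discarding the points stored since the reconstruction. What is left, \<open>S0 \<inter> S\<close>,
  can be exchanged with \<open>k\<close> and contains at least half of \<open>S0\<close>.\<close>

lemma emeasure_violating_insert_le:
  assumes M: "prob_space M" "sets M = sets borel"
    and inj: "AE \<omega> in Pi\<^sub>M (UNIV :: nat set) (\<lambda>_. M). inj (\<lambda>i. snd (\<omega> i))"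
    and fin: "finite S0" "finite S" and k: "k \<notin> S0" "k \<notin> S"
    and S0: "card S0 > 0" "num_buckets (card S0) > 0" "2 * card (S0 - S) \<le> card S0"
  shows "emeasure (Pi\<^sub>M UNIV (\<lambda>_. M))
      {\<omega> \<in> space (Pi\<^sub>M UNIV (\<lambda>_. M)). violating \<omega> S0 S (insert k S) k}
    \<le> ennreal (2 * real (num_buckets (card S0)) / real (card S0))"
proof -
  let ?P = "Pi\<^sub>M (UNIV :: nat set) (\<lambda>_. M)" and ?A = "S0 \<inter> S" and ?n = "card S0"
  interpret P: prob_space ?P by (intro prob_space_PiM M)
  let ?L = "{\<omega> \<in> space ?P. lowest \<omega> S0 (insert k ?A) k}"
  note pred_lowest[OF M(2) fin(1), measurable]
  have "card ?A + card (S0 - S) = card S0"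
    using fin by (subst card_Un_disjoint[symmetric]) (auto intro: arg_cong[where f = card])
  then have "?n \<le> 2 * Suc (card ?A)" using S0(3) by (simp add: algebra_simps)
  then have A: "real ?n \<le> 2 * real (Suc (card ?A))" by linarith
  have "of_nat (Suc (card ?A)) * emeasure ?P ?L \<le> of_nat (num_buckets ?n)"
    by (rule emeasure_lowest_insert_le[OF M(2,1) fin(1) k(1) _ S0(2) inj]) auto
  then have "ennreal (real (Suc (card ?A)) * P.prob ?L) \<le> ennreal (real (num_buckets ?n))"
    by (simp only: P.emeasure_eq_measure ennreal_of_nat_eq_real_of_nat ennreal_mult[symmetric]
        of_nat_0_le_iff measure_nonneg)
  then have le: "real (Suc (card ?A)) * P.prob ?L \<le> real (num_buckets ?n)"
    by (subst (asm) ennreal_le_iff) auto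
  have "real ?n * P.prob ?L \<le> 2 * real (Suc (card ?A)) * P.prob ?L"
    using A by (intro mult_right_mono) auto
  also have "\<dots> \<le> 2 * real (num_buckets ?n)"
    using mult_left_mono[OF le, of 2] by (simp only: mult.assoc)
  finally have "P.prob ?L \<le> 2 * real (num_buckets ?n) / real ?n"
    using S0(1) by (simp add: le_divide_eq mult.commute)
  moreover have "emeasure ?P {\<omega> \<in> space ?P. violating \<omega> S0 S (insert k S) k} \<le> emeasure ?P ?L"
  proof (rule emeasure_mono)
    show "{\<omega> \<in> space ?P. violating \<omega> S0 S (insert k S) k} \<subseteq> ?L"
      using violating_insert[OF _ k(2)] by (auto intro: lowest_mono)
  qed measurable
  ultimately show ?thesis
    unfolding P.emeasure_eq_measure[of ?L] by (meson ennreal_leI order_trans)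
qed

text \<open>The two kinds of update use Fubini in opposite orders: an insertion is bounded for fixed
  labels over random coordinates, a deletion for fixed coordinates over random labels.\<close>

lemma prob_violating_le:
  fixes us :: "update list"
  defines "v \<equiv> \<lambda>h t (ls, \<omega>). violating \<omega> (stored (take h us) ls)
    (stored (take t us) ls) (stored (take (Suc t) us) ls) (ls ! t)"
  assumes M: "prob_space M" "sets M = sets borel"
    and inj: "AE \<omega> in Pi\<^sub>M (UNIV :: nat set) (\<lambda>_. M). inj (\<lambda>i. snd (\<omega> i))"
    and us: "feasible us" "h \<le> t" "t < length us" "2 * (t - h) \<le> n"
    and n: "num_stored (take h us) = n" "n \<le> num_stored (take t us)" "n \<ge> 2"
  defines "Q \<equiv> measure_pmf (updated_labels us 0 {}) \<Otimes>\<^sub>M Pi\<^sub>M UNIV (\<lambda>_. M)"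
  shows "measure Q {w \<in> space Q. v h t w} \<le> 2 * real (num_buckets n) / real n"
proof -
  let ?N = "measure_pmf (updated_labels us 0 {})" and ?P = "Pi\<^sub>M (UNIV :: nat set) (\<lambda>_. M)"
  let ?V = "{w \<in> space Q. v h t w}" and ?b = "ennreal (2 * real (num_buckets n) / real n)"
  interpret X: prob_space ?P by (intro prob_space_PiM M)
  interpret pair: pair_prob_space ?N ?P ..
  have space_M: "space M = UNIV" using sets_eq_imp_space_eq[OF M(2)] by simp
  have "(\<lambda>w. v h t w) = (\<lambda>w. violating (snd w) (stored (take h us) (fst w))
    (stored (take t us) (fst w)) (stored (take (Suc t) us) (fst w)) (fst w ! t))"
    by (simp add: v_def case_prod_beta)
  then have "Measurable.pred Q (v h t)"
    unfolding Q_def by (simp only:) (rule pred_violating_pair[OF M(2) finite_stored])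
  then have meas: "?V \<in> sets (?N \<Otimes>\<^sub>M ?P)" unfolding pred_def Q_def .
  have K: "num_buckets n > 0" using num_buckets_bounds(1)[OF n(3)] .
  have step: "stored (take (Suc t) us) ls = update_set (us ! t) (ls ! t) (stored (take t us) ls)"
    and card0: "card (stored (take h us) ls) = n"
    if "ls \<in> set_pmf (updated_labels us 0 {})" for ls
    using stored_take_Suc[of t us ls] updated_labels_support[OF that us(1)] us(3)
      updated_labels_support_take(3)[OF that us(1), of h] n(1) by auto
  have "emeasure Q ?V \<le> ?b"
  proof (cases "us ! t")
    case Insert
    have "emeasure Q ?V = (\<integral>\<^sup>+ls. emeasure ?P (Pair ls -` ?V) \<partial>?N)"
      using X.emeasure_pair_measure_alt[OF meas] by (simp add: Q_def)
    also have "\<dots> \<le> (\<integral>\<^sup>+ls. ?b \<partial>?N)"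
    proof (rule nn_integral_mono_AE, unfold AE_measure_pmf_iff, rule ballI)
      fix ls assume ls: "ls \<in> set_pmf (updated_labels us 0 {})"
      let ?R = "stored (take h us) ls" and ?S = "stored (take t us) ls"
      have k: "ls ! t = count_list (take t us) Insert"
        using updated_label_support(1)[OF ls us(1,3) Insert] .
      have "count_list (take h us) Insert \<le> count_list (take t us) Insert"
        using take_add[of h "t - h" us] us(2) by simp
      \<comment> \<open>The new label equals the number of earlier insertions, and all labels stored
        at time \<open>h\<close> or \<open>t\<close> are smaller.\<close>
      then have notin: "ls ! t \<notin> ?R" "ls ! t \<notin> ?S"
        using updated_labels_support_take(2)[OF ls us(1)] unfolding k by force+
      have "card (?R - ?S) \<le> t - h"
        using card_stored_diff_le[of ls us h "t - h"] updated_labels_support[OF ls us(1)] us(2,3)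
        by (simp add: finite_stored)
      then have "2 * card (?R - ?S) \<le> card ?R" using us(4) card0[OF ls] by simp
      moreover have "Pair ls -` ?V = {\<omega> \<in> space ?P. violating \<omega> ?R ?S (insert (ls ! t) ?S) (ls ! t)}"
        by (auto simp: v_def Q_def space_pair_measure step[OF ls] Insert)
      ultimately show "emeasure ?P (Pair ls -` ?V) \<le> ?b"
        using emeasure_violating_insert_le[OF M inj finite_stored finite_stored notin] K n(3)
        by (simp add: card0[OF ls])
    qed
    finally show ?thesis by simp
  next
    case Delete
    have "emeasure Q ?V = (\<integral>\<^sup>+\<omega>. emeasure ?N ((\<lambda>ls. (ls, \<omega>)) -` ?V) \<partial>?P)"
      using pair.emeasure_pair_measure_alt2[OF meas] by (simp add: Q_def)
    also have "\<dots> \<le> (\<integral>\<^sup>+\<omega>. ?b \<partial>?P)"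
    proof (rule nn_integral_mono_AE)
      show "AE \<omega> in ?P. emeasure ?N ((\<lambda>ls. (ls, \<omega>)) -` ?V) \<le> ?b"
        using inj
      proof eventually_elim
        case (elim \<omega>)
        have "emeasure ?N ((\<lambda>ls. (ls, \<omega>)) -` ?V) \<le>
          emeasure ?N {ls. lowest \<omega> (stored (take h us) ls) (stored (take t us) ls) (ls ! t)}"
        proof (rule emeasure_mono_AE, unfold AE_measure_pmf_iff, intro ballI impI)
          fix ls assume ls: "ls \<in> set_pmf (updated_labels us 0 {})" "ls \<in> (\<lambda>ls. (ls, \<omega>)) -` ?V"
          then have "violating \<omega> (stored (take h us) ls) (stored (take t us) ls)
            (stored (take t us) ls - {ls ! t}) (ls ! t)"
            by (simp add: v_def step[OF ls(1)] Delete)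
          then show "ls \<in> {ls. lowest \<omega> (stored (take h us) ls) (stored (take t us) ls) (ls ! t)}"
            using violating_delete updated_label_support(2)[OF ls(1) us(1,3) Delete] by simp
        qed simp
        also have "\<dots> \<le> ennreal (real (num_buckets n) / real n)"
          using K n us Delete elim by (intro emeasure_lowest_delete_le) auto
        also have "\<dots> \<le> ?b" by (intro ennreal_leI divide_right_mono) auto
        finally show ?case .
      qed
    qed
    also have "\<dots> = ?b" by (simp add: X.emeasure_space_1)
    finally show ?thesis .
  qed
  then show ?thesis
    unfolding Q_def by (simp add: pair.P.emeasure_eq_measure)
qed

section \<open>Summation over the epoch\<close>

lemma num_violating_eq_sum:
  "real (num_violating hist ep w) = (\<Sum>m<length ep.
     indicator {w. violating (snd w) (stored hist (fst w))
       (stored (hist @ take m ep) (fst w)) (stored (hist @ take (Suc m) ep) (fst w))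
       (fst w ! (length hist + m))} w)"
proof -
  have "real (card {m. m < L \<and> Q m}) = (\<Sum>m<L. if Q m then 1 else 0)" for L :: nat and Q
    using sum.inter_filter[of "{..<L}" "\<lambda>_. 1 :: real" Q] by simp
  then show ?thesis
    unfolding num_violating_def case_prod_beta indicator_def mem_Collect_eq of_bool_def .
qed

theorem theorem1:
  fixes c r :: real
  assumes "c > 0" and "r > 1"
  shows "\<exists>C::real. \<forall>(\<mu> :: real \<times> real \<Rightarrow> ennreal) (n::nat) (hist :: update list) (ep :: update list).
           \<mu> \<in> borel_measurable lborel \<longrightarrow>
           prob_space (density lborel \<mu>) \<longrightarrow>
           feasible (hist @ ep) \<longrightarrow>
           num_stored hist = n \<longrightarrow>
           n \<ge> 2 \<longrightarrow>
           real (length ep) \<le> c * log 2 (real n) \<longrightarrow>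
           (\<forall>m\<le>length ep. n \<le> num_stored (hist @ take m ep) \<and>
                          real (num_stored (hist @ take m ep)) \<le> r * real n) \<longrightarrow>
           integrable (update_space \<mu> (hist @ ep)) (\<lambda>w. real (num_violating hist ep w)) \<and>
           (\<integral>w. real (num_violating hist ep w) \<partial>update_space \<mu> (hist @ ep)) \<le> C"
\<comment> \<open>The two summands are the bounds of the cases of large and small \<open>n\<close>;
  both are nonnegative, so the sum serves for either.\<close>
proof (rule exI[of _ "4 * c + 32 * c\<^sup>2"], intro allI impI, goal_cases)
  case (1 \<mu> n hist ep)
  let ?M = "density lborel \<mu>" and ?us = "hist @ ep" and ?h = "length hist"
  let ?L = "length ep" and ?Q = "update_space \<mu> (hist @ ep)"
  define V where "V m = {w. violating (snd w) (stored hist (fst w))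
       (stored (hist @ take m ep) (fst w)) (stored (hist @ take (Suc m) ep) (fst w))
       (fst w ! (?h + m))}" for m
  note [measurable] = 1(1)
  have M: "prob_space ?M" "sets ?M = sets borel" by (fact 1(2)) simp
  interpret X: prob_space "Pi\<^sub>M (UNIV :: nat set) (\<lambda>_. ?M)" by (intro prob_space_PiM M)
  interpret pair: pair_prob_space "measure_pmf (updated_labels ?us 0 {})" "Pi\<^sub>M (UNIV :: nat set) (\<lambda>_. ?M)" ..
  have Q: "prob_space ?Q" unfolding update_space_def by (rule pair.P.prob_space_axioms)
  interpret Q: prob_space ?Q by (rule Q)
  have inj: "AE \<omega> in Pi\<^sub>M (UNIV :: nat set) (\<lambda>_. ?M). inj (\<lambda>i. snd (\<omega> i))"
  proof (rule AE_PiM_inj[OF M(1) _ AE_density_snd_neq[OF 1(1)]])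
    show "snd \<in> borel_measurable ?M"
      by (subst measurable_cong_sets[OF M(2) refl]) (intro borel_measurable_continuous_onI continuous_intros)
  qed
  have V_meas: "V m \<inter> space ?Q \<in> sets ?Q" for m
  proof -
    have "Measurable.pred (measure_pmf (updated_labels ?us 0 {}) \<Otimes>\<^sub>M Pi\<^sub>M UNIV (\<lambda>_. ?M))
      (\<lambda>w. violating (snd w) (stored hist (fst w)) (stored (hist @ take m ep) (fst w))
        (stored (hist @ take (Suc m) ep) (fst w)) (fst w ! (?h + m)))"
      by (rule pred_violating_pair[OF M(2) finite_stored])
    then show ?thesis
      unfolding V_def update_space_def pred_def by (simp only: Int_def mem_Collect_eq conj_commute)
  qed
  have num: "real (num_violating hist ep w) = (\<Sum>m<?L. indicator (V m \<inter> space ?Q) w)"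
    if "w \<in> space ?Q" for w
    unfolding num_violating_eq_sum V_def using that by (simp add: indicator_def)
  have int_V: "integrable ?Q (indicator (V m \<inter> space ?Q) :: _ \<Rightarrow> real)" for m
    by (rule integrable_real_indicator[OF V_meas]) (simp add: less_top[symmetric])
  have int: "integrable ?Q (\<lambda>w. real (num_violating hist ep w))"
    by (subst Bochner_Integration.integrable_cong[OF refl num], assumption)
       (intro Bochner_Integration.integrable_sum int_V)
  have "(\<integral>w. real (num_violating hist ep w) \<partial>?Q) = (\<integral>w. (\<Sum>m<?L. indicator (V m \<inter> space ?Q) w) \<partial>?Q)"
    by (intro Bochner_Integration.integral_cong refl num)
  also have "\<dots> = (\<Sum>m<?L. measure ?Q (V m \<inter> space ?Q))"
    by (subst Bochner_Integration.integral_sum) (simp_all add: int_V V_meas)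
  finally have eq: "(\<integral>w. real (num_violating hist ep w) \<partial>?Q) = (\<Sum>m<?L. measure ?Q (V m \<inter> space ?Q))" .
  have l: "log 2 (real n) > 0" using 1(5) by simp
  have "(\<Sum>m<?L. measure ?Q (V m \<inter> space ?Q)) \<le> 4 * c + 32 * c\<^sup>2"
  proof (cases "2 * c * log 2 (real n) \<le> real n")
    case True
    have "measure ?Q (V m \<inter> space ?Q) \<le> 4 / log 2 (real n)" if m: "m < ?L" for m
    proof -
      \<comment> \<open>Hence at most half of the points of the reconstruction are deleted before
        update \<open>m\<close>.\<close>
      have "2 * real m \<le> real n" using True 1(6) m by simp
      then have "2 * m \<le> n" by linarith
      moreover have "take ?h ?us = hist" "take (?h + m) ?us = hist @ take m ep"
        "take (Suc (?h + m)) ?us = hist @ take (Suc m) ep"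
        by (simp_all add: Suc_diff_le)
      moreover have "V m \<inter> space ?Q = {w \<in> space ?Q. case w of (ls, \<omega>) \<Rightarrow> violating \<omega> (stored hist ls)
        (stored (hist @ take m ep) ls) (stored (hist @ take (Suc m) ep) ls) (ls ! (?h + m))}"
        by (auto simp: V_def)
      ultimately have "measure ?Q (V m \<inter> space ?Q) \<le> 2 * real (num_buckets n) / real n"
        using prob_violating_le[OF M inj 1(3), of ?h "?h + m" n] m 1(4,5,7)
        by (simp add: update_space_def)
      also have "\<dots> \<le> 2 * (2 * real n / log 2 (real n)) / real n"
        using num_buckets_bounds(2)[OF 1(5)] by (intro divide_right_mono mult_left_mono) auto
      also have "\<dots> = 4 / log 2 (real n)" using 1(5) by simp
      finally show ?thesis .
    qed
    then have "(\<Sum>m<?L. measure ?Q (V m \<inter> space ?Q)) \<le> real ?L * (4 / log 2 (real n))"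
      using sum_bounded_above[of "{..<?L}" "\<lambda>m. measure ?Q (V m \<inter> space ?Q)" "4 / log 2 (real n)"] by simp
    also have "\<dots> \<le> c * log 2 (real n) * (4 / log 2 (real n))"
      using 1(6) l by (intro mult_right_mono) auto
    also have "\<dots> = 4 * c" using l by simp
    finally show ?thesis by (simp add: add_increasing2)
  next
    case False
    have sqrt: "log 2 (real n) \<le> 4 * sqrt (real n)" using 1(5) by (intro log2_le_sqrt) auto
    have "2 * c * log 2 (real n) \<le> 2 * c * (4 * sqrt (real n))"
      using assms(1) by (intro mult_left_mono sqrt) auto
    \<comment> \<open>This bounds \<open>sqrt (real n)\<close> by \<open>8 * c\<close>, hence the
      length of the epoch by \<open>32 * c\<^sup>2\<close>; each violation probability is then
      estimated by 1.\<close>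
    with False have "real n < 2 * c * (4 * sqrt (real n))" by linarith
    then have "sqrt (real n) * sqrt (real n) < 8 * c * sqrt (real n)" by simp
    then have "sqrt (real n) < 8 * c"
      by (rule mult_right_less_imp_less) simp
    then have "c * log 2 (real n) \<le> c * (4 * (8 * c))"
      using sqrt assms(1) by (intro mult_left_mono) auto
    moreover have "(\<Sum>m<?L. measure ?Q (V m \<inter> space ?Q)) \<le> real ?L"
      using sum_bounded_above[of "{..<?L}" "\<lambda>m. measure ?Q (V m \<inter> space ?Q)" 1] by simp
    moreover have "c * (4 * (8 * c)) = 32 * c\<^sup>2" by (simp add: power2_eq_square)
    ultimately show ?thesis using 1(6) assms(1) by linarith
  qed
  with int eq show ?case by simp
qed

end
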